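(* Let $(\Omega^\bullet,d)$ be a differential calculus on an algebra $A$, and let $V$ be a vector space of derivations on $A$, closed under commutator, for which the interior products and Lie derivatives are well defined. For all $\theta\in V$, all $n\ge 0$ and all $\omega\in\Omega^n$, $$d\,{\cal L}_\theta(\omega)={\cal L}_\theta(d\omega).$$
   Context: $A$ is an associative unital (not necessarily commutative) algebra over a field. A differential calculus on $A$ is a collection of $A$-bimodules $\Omega^n$, $n\ge 0$, with $\Omega^0=A$, with an associative graded product $\Omega^n\times\Omega^m\to\Omega^{n+m}$ extending the bimodule structure, and with a linear signed derivation $d:\Omega^n\to\Omega^{n+1}$, i.e. $d(\omega\tau)=d(\omega)\,\tau+(-1)^{|\omega|}\omega\,d(\tau)$ (where $|\omega|=n$ if $\omega\in\Omega^n$), such that $d^2=0$ and $\Omega^{n+1}$ is spanned by the elements $\omega\,db$ with $\omega\in\Omega^n$, $b\in A$. Everything is purely algebraic (no topology). $V$ is a vector space of linear maps $\theta:A\to A$ with $\theta(ab)=\theta(a)b+a\theta(b)$, closed under the commutator $[\theta,\phi]=\theta\phi-\phi\theta$. Interior product: for $\theta\in V$, $\theta\lrcorner:\Omega^{n+1}\to\Omega^n$ is the linear map determined by $\theta\lrcorner a=0$ for $a\in\Omega^0=A$, $\theta\lrcorner da=\theta(a)$, and $\theta\lrcorner(\omega\tau)=(\theta\lrcorner\,\omega)\tau+(-1)^{|\omega|}\omega(\theta\lrcorner\tau)$. Lie derivative: for $\theta\in V$, ${\cal L}_\theta:\Omega^n\to\Omega^n$ is the linear map determined by ${\cal L}_\theta(a)=\theta(a)$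 for $a\in\Omega^0=A$, ${\cal L}_\theta(da)=d(\theta(a))$, and ${\cal L}_\theta(\omega\tau)={\cal L}_\theta(\omega)\tau+\omega{\cal L}_\theta(\tau)$. Standing assumption: for every $\theta\in V$ the maps $\theta\lrcorner$ and ${\cal L}_\theta$ are well defined on all of $\Omega^\bullet$ (i.e. compatible with all relations in the calculus). *)

theory Defs
  imports Complex_Main
begin

text \<open>
  The sort \<open>{ring, monoid_mult}\<close> is that of unital associative rings; unlike \<open>ring_1\<close> it does not
  exclude the zero ring.
\<close>

locale algebra_over_field = vector_space scaleA
  for scaleA :: "'k::field \<Rightarrow> 'a::{ring,monoid_mult} \<Rightarrow> 'a" +
  assumes scale_mult_left: "scaleA c (a * b) = scaleA c a * b"
    and scale_mult_right: "scaleA c (a * b) = a * scaleA c b"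

definition linear_between ::
    "('k \<Rightarrow> 'v \<Rightarrow> 'v) \<Rightarrow> ('k \<Rightarrow> 'w \<Rightarrow> 'w) \<Rightarrow> 'v::ab_group_add set \<Rightarrow> 'w::ab_group_add set \<Rightarrow> ('v \<Rightarrow> 'w) \<Rightarrow> bool"
  where "linear_between scaleV scaleW S T f \<longleftrightarrow>
    (\<forall>x\<in>S. f x \<in> T) \<and>
    (\<forall>x\<in>S. \<forall>y\<in>S. f (x + y) = f x + f y) \<and>
    (\<forall>c. \<forall>x\<in>S. f (scaleV c x) = scaleW c (f x))"

text \<open>
  Bimodules are carried by a subspace \<open>M\<close> of a vector space \<open>'w\<close>.  They are bimodules over the
  algebra, so both actions are bilinear over the ground field.
\<close>

locale bimodule = A: algebra_over_field scaleA + W: vector_space scaleW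
  for scaleA :: "'k::field \<Rightarrow> 'a::{ring,monoid_mult} \<Rightarrow> 'a"
    and scaleW :: "'k \<Rightarrow> 'w::ab_group_add \<Rightarrow> 'w" +
  fixes M :: "'w set"
    and lact :: "'a \<Rightarrow> 'w \<Rightarrow> 'w"
    and ract :: "'w \<Rightarrow> 'a \<Rightarrow> 'w"
  assumes subspace: "W.subspace M"
    and lact_linear: "linear_between scaleW scaleW M M (lact a)"
    and lact_linear_scalar: "x \<in> M \<Longrightarrow> linear_between scaleA scaleW UNIV M (\<lambda>a. lact a x)"
    and ract_linear: "linear_between scaleW scaleW M M (\<lambda>x. ract x a)"
    and ract_linear_scalar: "x \<in> M \<Longrightarrow> linear_between scaleA scaleW UNIV M (ract x)"
    and lact_one: "x \<in> M \<Longrightarrow> lact 1 x = x"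
    and ract_one: "x \<in> M \<Longrightarrow> ract x 1 = x"
    and lact_lact: "x \<in> M \<Longrightarrow> lact a (lact b x) = lact (a * b) x"
    and ract_ract: "x \<in> M \<Longrightarrow> ract (ract x a) b = ract x (a * b)"
    and lact_ract: "x \<in> M \<Longrightarrow> ract (lact a x) b = lact a (ract x b)"

text \<open>
  The spaces \<open>\<Omega> n\<close> are subspaces of one vector space \<open>'w\<close>, but all operations are indexed by the
  degrees of their arguments, and the \<open>\<Omega> n\<close> are not required to be independent or even distinct;
  so this is just a family of vector spaces.  \<open>mul n m\<close> is the product
  \<open>\<Omega> n \<times> \<Omega> m \<rightarrow> \<Omega> (n + m)\<close> and \<open>d n\<close> the differential \<open>\<Omega> n \<rightarrow> \<Omega> (n + 1)\<close>; only their values on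
  these sets matter.  The bijection \<open>\<iota>\<close> of the algebra onto \<open>\<Omega> 0\<close> expresses that \<open>\<Omega> 0\<close> is the
  algebra, regarded as a bimodule over itself.
\<close>

locale differential_calculus = A: algebra_over_field scaleA + W: vector_space scaleW
  for scaleA :: "'k::field \<Rightarrow> 'a::{ring,monoid_mult} \<Rightarrow> 'a"
    and scaleW :: "'k \<Rightarrow> 'w::ab_group_add \<Rightarrow> 'w" +
  fixes \<Omega> :: "nat \<Rightarrow> 'w set"
    and lact :: "nat \<Rightarrow> 'a \<Rightarrow> 'w \<Rightarrow> 'w"
    and ract :: "nat \<Rightarrow> 'w \<Rightarrow> 'a \<Rightarrow> 'w"
    and \<iota> :: "'a \<Rightarrow> 'w"
    and mul :: "nat \<Rightarrow> nat \<Rightarrow> 'w \<Rightarrow> 'w \<Rightarrow> 'w"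
    and d :: "nat \<Rightarrow> 'w \<Rightarrow> 'w"
  assumes bimodules: "bimodule scaleA scaleW (\<Omega> n) (lact n) (ract n)"
    and iota_linear: "linear_between scaleA scaleW UNIV (\<Omega> 0) \<iota>"
    and iota_bij: "bij_betw \<iota> UNIV (\<Omega> 0)"
    and lact_iota: "lact 0 a (\<iota> b) = \<iota> (a * b)"
    and ract_iota: "ract 0 (\<iota> a) b = \<iota> (a * b)"
    and mul_linear_left: "\<tau> \<in> \<Omega> m \<Longrightarrow>
      linear_between scaleW scaleW (\<Omega> n) (\<Omega> (n + m)) (\<lambda>\<omega>. mul n m \<omega> \<tau>)"
    and mul_linear_right: "\<omega> \<in> \<Omega> n \<Longrightarrow>
      linear_between scaleW scaleW (\<Omega> m) (\<Omega> (n + m)) (mul n m \<omega>)"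
    and mul_assoc: "\<omega> \<in> \<Omega> n \<Longrightarrow> \<tau> \<in> \<Omega> m \<Longrightarrow> \<rho> \<in> \<Omega> p \<Longrightarrow>
      mul (n + m) p (mul n m \<omega> \<tau>) \<rho> = mul n (m + p) \<omega> (mul m p \<tau> \<rho>)"
    and mul_iota_left: "\<omega> \<in> \<Omega> n \<Longrightarrow> mul 0 n (\<iota> a) \<omega> = lact n a \<omega>"
    and mul_iota_right: "\<omega> \<in> \<Omega> n \<Longrightarrow> mul n 0 \<omega> (\<iota> a) = ract n \<omega> a"
    and d_linear: "linear_between scaleW scaleW (\<Omega> n) (\<Omega> (n + 1)) (d n)"
    and d_mul: "\<omega> \<in> \<Omega> n \<Longrightarrow> \<tau> \<in> \<Omega> m \<Longrightarrow>
      d (n + m) (mul n m \<omega> \<tau>) =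
        mul (n + 1) m (d n \<omega>) \<tau> + scaleW ((-1) ^ n) (mul n (m + 1) \<omega> (d m \<tau>))"
    and d_d: "\<omega> \<in> \<Omega> n \<Longrightarrow> d (n + 1) (d n \<omega>) = 0"
    and spanned: "\<Omega> (n + 1) = W.span {mul n 1 \<omega> (d 0 (\<iota> b)) | \<omega> b. \<omega> \<in> \<Omega> n}"

locale derivation_space = algebra_over_field scaleA
  for scaleA :: "'k::field \<Rightarrow> 'a::{ring,monoid_mult} \<Rightarrow> 'a" +
  fixes V :: "('a \<Rightarrow> 'a) set"
  assumes linear: "\<theta> \<in> V \<Longrightarrow> linear_between scaleA scaleA UNIV UNIV \<theta>"
    and derivation: "\<theta> \<in> V \<Longrightarrow> \<theta> (a * b) = \<theta> a * b + a * \<theta> b"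
    and zero: "(\<lambda>a. 0) \<in> V"
    and add: "\<theta> \<in> V \<Longrightarrow> \<phi> \<in> V \<Longrightarrow> (\<lambda>a. \<theta> a + \<phi> a) \<in> V"
    and scale: "\<theta> \<in> V \<Longrightarrow> (\<lambda>a. scaleA c (\<theta> a)) \<in> V"
    and commutator: "\<theta> \<in> V \<Longrightarrow> \<phi> \<in> V \<Longrightarrow> (\<lambda>a. \<theta> (\<phi> a) - \<phi> (\<theta> a)) \<in> V"

text \<open>
  \<open>i n\<close> is the interior product on \<open>\<Omega> n\<close>.  It vanishes on \<open>\<Omega> 0\<close>, so that for \<open>n = 0\<close> or \<open>m = 0\<close> the
  corresponding summand of the product rule, whose degree \<open>n - 1\<close> or \<open>m - 1\<close> is truncated, is \<open>0\<close>.
\<close>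

definition is_interior_product ::
    "('k::field \<Rightarrow> 'w::ab_group_add \<Rightarrow> 'w) \<Rightarrow> (nat \<Rightarrow> 'w set) \<Rightarrow> ('a \<Rightarrow> 'w) \<Rightarrow>
     (nat \<Rightarrow> nat \<Rightarrow> 'w \<Rightarrow> 'w \<Rightarrow> 'w) \<Rightarrow> (nat \<Rightarrow> 'w \<Rightarrow> 'w) \<Rightarrow> ('a \<Rightarrow> 'a) \<Rightarrow> (nat \<Rightarrow> 'w \<Rightarrow> 'w) \<Rightarrow> bool"
  where "is_interior_product scaleW \<Omega> \<iota> mul d \<theta> i \<longleftrightarrow>
    (\<forall>n. linear_between scaleW scaleW (\<Omega> (n + 1)) (\<Omega> n) (i (n + 1))) \<and>
    (\<forall>a. i 0 (\<iota> a) = 0) \<and>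
    (\<forall>a. i 1 (d 0 (\<iota> a)) = \<iota> (\<theta> a)) \<and>
    (\<forall>n m. \<forall>\<omega>\<in>\<Omega> n. \<forall>\<tau>\<in>\<Omega> m.
      i (n + m) (mul n m \<omega> \<tau>) =
        mul (n - 1) m (i n \<omega>) \<tau> + scaleW ((-1) ^ n) (mul n (m - 1) \<omega> (i m \<tau>)))"

definition is_lie_derivative ::
    "('k::field \<Rightarrow> 'w::ab_group_add \<Rightarrow> 'w) \<Rightarrow> (nat \<Rightarrow> 'w set) \<Rightarrow> ('a \<Rightarrow> 'w) \<Rightarrow>
     (nat \<Rightarrow> nat \<Rightarrow> 'w \<Rightarrow> 'w \<Rightarrow> 'w) \<Rightarrow> (nat \<Rightarrow> 'w \<Rightarrow> 'w) \<Rightarrow> ('a \<Rightarrow> 'a) \<Rightarrow> (nat \<Rightarrow> 'w \<Rightarrow> 'w) \<Rightarrow> bool"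
  where "is_lie_derivative scaleW \<Omega> \<iota> mul d \<theta> L \<longleftrightarrow>
    (\<forall>n. linear_between scaleW scaleW (\<Omega> n) (\<Omega> n) (L n)) \<and>
    (\<forall>a. L 0 (\<iota> a) = \<iota> (\<theta> a)) \<and>
    (\<forall>a. L 1 (d 0 (\<iota> a)) = d 0 (\<iota> (\<theta> a))) \<and>
    (\<forall>n m. \<forall>\<omega>\<in>\<Omega> n. \<forall>\<tau>\<in>\<Omega> m.
      L (n + m) (mul n m \<omega> \<tau>) = mul n m (L n \<omega>) \<tau> + mul n m \<omega> (L m \<tau>))"

text \<open>
  If it exists, the Lie derivative is unique on every \<open>\<Omega> n\<close> (lemma
  \<open>is_lie_derivative_unique\<close> below), so the choice is immaterial there.
\<close>

definition lie_derivative ::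
    "('k::field \<Rightarrow> 'w::ab_group_add \<Rightarrow> 'w) \<Rightarrow> (nat \<Rightarrow> 'w set) \<Rightarrow> ('a \<Rightarrow> 'w) \<Rightarrow>
     (nat \<Rightarrow> nat \<Rightarrow> 'w \<Rightarrow> 'w \<Rightarrow> 'w) \<Rightarrow> (nat \<Rightarrow> 'w \<Rightarrow> 'w) \<Rightarrow> ('a \<Rightarrow> 'a) \<Rightarrow> nat \<Rightarrow> 'w \<Rightarrow> 'w"
  where "lie_derivative scaleW \<Omega> \<iota> mul d \<theta> = (SOME L. is_lie_derivative scaleW \<Omega> \<iota> mul d \<theta> L)"

lemma is_lie_derivativeD:
  assumes "is_lie_derivative scaleW \<Omega> \<iota> mul d \<theta> L"
  shows "linear_between scaleW scaleW (\<Omega> n) (\<Omega> n) (L n)"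
    and "L 0 (\<iota> a) = \<iota> (\<theta> a)"
    and "L 1 (d 0 (\<iota> a)) = d 0 (\<iota> (\<theta> a))"
    and "\<omega> \<in> \<Omega> n \<Longrightarrow> \<tau> \<in> \<Omega> m \<Longrightarrow>
      L (n + m) (mul n m \<omega> \<tau>) = mul n m (L n \<omega>) \<tau> + mul n m \<omega> (L m \<tau>)"
  using assms unfolding is_lie_derivative_def by blast+

context differential_calculus
begin

lemma subspace_forms: "W.subspace (\<Omega> n)"
  using bimodules[of n] by (rule bimodule.subspace)

lemma iota_form: "\<iota> a \<in> \<Omega> 0"
  using iota_bij by (auto simp: bij_betw_def)

lemma linear_between_eq_on_span:
  assumes f: "linear_between scaleW scaleW (\<Omega> n) T f" and g: "linear_between scaleW scaleW (\<Omega> n) T' g"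
    and S: "S \<subseteq> \<Omega> n" and eq: "\<And>x. x \<in> S \<Longrightarrow> f x = g x" and x: "x \<in> W.span S"
  shows "f x = g x"
proof -
  have 0: "0 \<in> \<Omega> n" using subspace_forms by (rule W.subspace_0)
  have "f (0 + 0) = f 0 + f 0" "g (0 + 0) = g 0 + g 0"
    using f g 0 unfolding linear_between_def by blast+
  then have f0: "f 0 = 0" and g0: "g 0 = 0" by simp_all
  have "W.subspace {x. x \<in> \<Omega> n \<and> f x = g x}"
  proof (rule W.subspaceI)
    show "0 \<in> {x. x \<in> \<Omega> n \<and> f x = g x}"
      using f0 g0 W.subspace_0[OF subspace_forms] by simp
    show "x + y \<in> {x. x \<in> \<Omega> n \<and> f x = g x}"
      if "x \<in> {x. x \<in> \<Omega> n \<and> f x = g x}" "y \<in> {x. x \<in> \<Omega> n \<and> f x = g x}" for x y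
      using that f g W.subspace_add[OF subspace_forms, of x n y] by (simp add: linear_between_def)
    show "scaleW c x \<in> {x. x \<in> \<Omega> n \<and> f x = g x}"
      if "x \<in> {x. x \<in> \<Omega> n \<and> f x = g x}" for c x
      using that f g W.subspace_scale[OF subspace_forms, of x n c] by (simp add: linear_between_def)
  qed
  then have "x \<in> \<Omega> n \<and> f x = g x"
    using W.span_induct[OF x, of "\<lambda>x. x \<in> \<Omega> n \<and> f x = g x"] S eq by auto
  then show ?thesis by simp
qed

lemma generator_form: "\<omega> \<in> \<Omega> n \<Longrightarrow> mul n 1 \<omega> (d 0 (\<iota> b)) \<in> \<Omega> (n + 1)"
  unfolding spanned[of n] by (rule W.span_base) blast

lemma d_iota_form: "d 0 (\<iota> b) \<in> \<Omega> 1"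
  using d_linear[of 0] iota_form unfolding linear_between_def by auto

lemma is_lie_derivative_unique:
  assumes L: "is_lie_derivative scaleW \<Omega> \<iota> mul d \<theta> L"
    and L': "is_lie_derivative scaleW \<Omega> \<iota> mul d \<theta> L'"
    and "\<omega> \<in> \<Omega> n"
  shows "L n \<omega> = L' n \<omega>"
  using \<open>\<omega> \<in> \<Omega> n\<close>
proof (induction n arbitrary: \<omega>)
  case 0
  then obtain a where "\<omega> = \<iota> a" using iota_bij by (auto simp: bij_betw_def)
  then show ?case using is_lie_derivativeD(2)[OF L] is_lie_derivativeD(2)[OF L'] by simp
next
  case (Suc n)
  let ?S = "{mul n 1 \<omega> (d 0 (\<iota> b)) | \<omega> b. \<omega> \<in> \<Omega> n}"
  have "L (n + 1) x = L' (n + 1) x" if "x \<in> ?S" for x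
  proof -
    from that obtain \<tau> b where x: "x = mul n 1 \<tau> (d 0 (\<iota> b))" and \<tau>: "\<tau> \<in> \<Omega> n" by blast
    have "M (n + 1) x = mul n 1 (M n \<tau>) (d 0 (\<iota> b)) + mul n 1 \<tau> (d 0 (\<iota> (\<theta> b)))"
      if "is_lie_derivative scaleW \<Omega> \<iota> mul d \<theta> M" for M
      unfolding x is_lie_derivativeD(4)[OF that \<tau> d_iota_form] is_lie_derivativeD(3)[OF that] ..
    from this[OF L] this[OF L'] show ?thesis by (simp only: Suc.IH[OF \<tau>])
  qed
  moreover have "?S \<subseteq> \<Omega> (n + 1)" using generator_form by blast
  moreover have "\<omega> \<in> W.span ?S"
    using Suc.prems spanned[of n] by simp
  ultimately have "L (n + 1) \<omega> = L' (n + 1) \<omega>"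
    using linear_between_eq_on_span[OF is_lie_derivativeD(1)[OF L] is_lie_derivativeD(1)[OF L'], of ?S "n + 1"]
    by blast
  then show ?case by simp
qed

end

end

theory Submission
  imports Defs
begin

text \<open>
  Both \<open>d \<circ> L\<close> and \<open>L \<circ> d\<close> are linear, and \<open>d (\<tau> db) = d\<tau> db\<close> because \<open>d\<^sup>2 = 0\<close>.  Hence
  \<open>d (L (\<tau> db)) = d (L \<tau>) db + d\<tau> d(\<theta> b)\<close> and \<open>L (d (\<tau> db)) = L (d \<tau>) db + d\<tau> d(\<theta> b)\<close>, and the
  claim follows by induction on the degree, since the forms \<open>\<tau> db\<close> span the next degree.
\<close>

text \<open>Needed because equality on a spanning set extends to the span only for linear maps, and
  both sides of the claim are composites of \<open>d\<close> and \<open>L\<close>.\<close>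

lemma linear_between_compose:
  assumes "linear_between scaleU scaleV S T f" and "linear_between scaleV scaleW T U g"
  shows "linear_between scaleU scaleW S U (\<lambda>x. g (f x))"
  using assms by (simp add: linear_between_def)

context differential_calculus
begin

lemma d_form: "\<omega> \<in> \<Omega> n \<Longrightarrow> d n \<omega> \<in> \<Omega> (n + 1)"
  using d_linear[of n] by (simp add: linear_between_def)

lemma mul_zero_right:
  assumes "\<omega> \<in> \<Omega> n"
  shows "mul n m \<omega> 0 = 0"
proof -
  have "mul n m \<omega> (0 + 0) = mul n m \<omega> 0 + mul n m \<omega> 0"
    using mul_linear_right[OF assms, of m] W.subspace_0[OF subspace_forms[of m]]
    unfolding linear_between_def by blast
  then show ?thesis by simp
qed

text \<open>The signed term of the Leibniz rule contains \<open>d 1 (d 0 (\<iota> b)) = 0\<close>.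
  So \<open>d\<close> takes a spanning element to one of the same shape, and the product rule of
  \<open>L\<close> applies to it again.\<close>

lemma d_mul_d_iota:
  assumes "\<omega> \<in> \<Omega> n"
  shows "d (n + 1) (mul n 1 \<omega> (d 0 (\<iota> b))) = mul (n + 1) 1 (d n \<omega>) (d 0 (\<iota> b))"
proof -
  have "d 1 (d 0 (\<iota> b)) = 0"
    using d_d[OF iota_form] by simp
  then show ?thesis
    using d_mul[OF assms d_iota_form] by (simp add: mul_zero_right[OF assms])
qed

lemma d_lie_derivative:
  assumes L: "is_lie_derivative scaleW \<Omega> \<iota> mul d \<theta> L" and "\<omega> \<in> \<Omega> n"
  shows "d n (L n \<omega>) = L (n + 1) (d n \<omega>)"
  using \<open>\<omega> \<in> \<Omega> n\<close>
proof (induction n arbitrary: \<omega>)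
  case 0
  then obtain a where "\<omega> = \<iota> a" using iota_bij by (auto simp: bij_betw_def)
  \<comment> \<open>Both sides equal \<open>d 0 (\<iota> (\<theta> a))\<close>.\<close>
  then show ?case using is_lie_derivativeD(2,3)[OF L] by simp
next
  case (Suc n)
  let ?S = "{mul n 1 \<tau> (d 0 (\<iota> b)) | \<tau> b. \<tau> \<in> \<Omega> n}"
  have eq: "d (n + 1) (L (n + 1) x) = L (n + 1 + 1) (d (n + 1) x)" if "x \<in> ?S" for x
  proof -
    from that obtain \<tau> b where x: "x = mul n 1 \<tau> (d 0 (\<iota> b))" and \<tau>: "\<tau> \<in> \<Omega> n" by blast
    have L\<tau>: "L n \<tau> \<in> \<Omega> n"
      using is_lie_derivativeD(1)[OF L] \<tau> by (simp add: linear_between_def)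
    have "L (n + 1) x = mul n 1 (L n \<tau>) (d 0 (\<iota> b)) + mul n 1 \<tau> (d 0 (\<iota> (\<theta> b)))"
      unfolding x is_lie_derivativeD(4)[OF L \<tau> d_iota_form] is_lie_derivativeD(3)[OF L] ..
    \<comment> \<open>Additivity holds only inside \<open>\<Omega> (n + 1)\<close>; both summands of
      \<open>L (n + 1) x\<close> lie there, being spanning elements themselves.\<close>
    moreover have "d (n + 1) (y + z) = d (n + 1) y + d (n + 1) z"
      if "y \<in> \<Omega> (n + 1)" "z \<in> \<Omega> (n + 1)" for y z
      using d_linear[of "n + 1"] that unfolding linear_between_def by blast
    ultimately have "d (n + 1) (L (n + 1) x) =
        mul (n + 1) 1 (d n (L n \<tau>)) (d 0 (\<iota> b)) + mul (n + 1) 1 (d n \<tau>) (d 0 (\<iota> (\<theta> b)))"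
      by (simp only: generator_form \<tau> L\<tau> d_mul_d_iota)
    \<comment> \<open>The induction hypothesis turns \<open>d n (L n \<tau>)\<close> into
      \<open>L (n + 1) (d n \<tau>)\<close>; the sum is then the product rule of \<open>L\<close>
      for \<open>d n \<tau>\<close> and \<open>d 0 (\<iota> b)\<close>.\<close>
    also have "\<dots> = L (n + 1 + 1) (d (n + 1) x)"
      unfolding x d_mul_d_iota[OF \<tau>] is_lie_derivativeD(4)[OF L d_form[OF \<tau>] d_iota_form]
        is_lie_derivativeD(3)[OF L] Suc.IH[OF \<tau>] ..
    finally show ?thesis .
  qed
  have "?S \<subseteq> \<Omega> (n + 1)" using generator_form by blast
  moreover have "\<omega> \<in> W.span ?S" using Suc.prems spanned[of n] by simp
  ultimately have "d (n + 1) (L (n + 1) \<omega>) = L (n + 1 + 1) (d (n + 1) \<omega>)"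
    using linear_between_eq_on_span
      [OF linear_between_compose[OF is_lie_derivativeD(1)[OF L] d_linear]
        linear_between_compose[OF d_linear is_lie_derivativeD(1)[OF L]]] eq
    by blast
  then show ?case by simp
qed

end

theorem proposition2p6:
  fixes scaleA :: "'k::field \<Rightarrow> 'a::{ring,monoid_mult} \<Rightarrow> 'a"
    and scaleW :: "'k \<Rightarrow> 'w::ab_group_add \<Rightarrow> 'w"
    and \<Omega> :: "nat \<Rightarrow> 'w set"
    and lact :: "nat \<Rightarrow> 'a \<Rightarrow> 'w \<Rightarrow> 'w"
    and ract :: "nat \<Rightarrow> 'w \<Rightarrow> 'a \<Rightarrow> 'w"
    and \<iota> :: "'a \<Rightarrow> 'w"
    and mul :: "nat \<Rightarrow> nat \<Rightarrow> 'w \<Rightarrow> 'w \<Rightarrow> 'w"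
    and d :: "nat \<Rightarrow> 'w \<Rightarrow> 'w"
    and V :: "('a \<Rightarrow> 'a) set"
    and \<theta> :: "'a \<Rightarrow> 'a"
    and n :: nat
    and \<omega> :: 'w
  assumes "differential_calculus scaleA scaleW \<Omega> lact ract \<iota> mul d"
    and "derivation_space scaleA V"
    and "\<forall>\<theta>\<in>V. \<exists>i. is_interior_product scaleW \<Omega> \<iota> mul d \<theta> i"
    and "\<forall>\<theta>\<in>V. \<exists>L. is_lie_derivative scaleW \<Omega> \<iota> mul d \<theta> L"
    and "\<theta> \<in> V"
    and "\<omega> \<in> \<Omega> n"
  shows "d n (lie_derivative scaleW \<Omega> \<iota> mul d \<theta> n \<omega>) =
         lie_derivative scaleW \<Omega> \<iota> mul d \<theta> (n + 1) (d n \<omega>)"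
proof -
  \<comment> \<open>Well-definedness provides some Lie derivative of \<theta>, so the chosen one has
    the defining properties.\<close>
  have "is_lie_derivative scaleW \<Omega> \<iota> mul d \<theta> (lie_derivative scaleW \<Omega> \<iota> mul d \<theta>)"
    unfolding lie_derivative_def by (rule someI_ex[OF bspec[OF assms(4,5)]])
  then show ?thesis
    using differential_calculus.d_lie_derivative[OF assms(1)] assms(6) by blast
qed

end
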